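(* There exists a constant $c>0$ such that for every integer $k\geq 1$ there exists a planar graph $G$ with $n=6k-2$ vertices whose planar edge-length ratio satisfies $\rho(G)\geq c\cdot n$; that is, there exist $n$-vertex planar graphs with planar edge-length ratio in $\Omega(n)$.
   Context: For a straight-line drawing $\Gamma$ of a graph $G$ (vertices as points, edges as straight-line segments), the edge-length ratio is $\rho(\Gamma)=\max_{e_1,e_2\in E(G)} \ell_\Gamma(e_1)/\ell_\Gamma(e_2)$, where $\ell_\Gamma(e)$ is the Euclidean length of the segment representing $e$. A drawing is planar if no two edges intersect except at common end-vertices. The planar edge-length ratio $\rho(G)$ of a planar graph $G$ is the minimum of $\rho(\Gamma)$ over all planar straight-line drawings $\Gamma$ of $G$. *)

theory Defs
  imports "HOL-Analysis.Analysis"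
begin

text \<open>
  The Euclidean plane is represented by the type \<^typ>\<open>complex\<close>, whose \<^const>\<open>dist\<close> is the
  Euclidean distance.
\<close>

definition simple_graph :: "'a set \<Rightarrow> 'a set set \<Rightarrow> bool" where
  "simple_graph V E \<longleftrightarrow> finite V \<and> (\<forall>e\<in>E. e \<subseteq> V \<and> card e = 2)"

text \<open>
  Planarity is the topological notion: edges may be drawn as arbitrary Jordan arcs. Asking in
  addition that arcs avoid non-incident vertices would only concern isolated vertices, which can
  always be moved off the edges; the same applies to straight-line drawings below.
\<close>

definition planar_graph :: "'a set \<Rightarrow> 'a set set \<Rightarrow> bool" where
  "planar_graph V E \<longleftrightarrow>
     (\<exists>(p :: 'a \<Rightarrow> complex) (\<gamma> :: 'a set \<Rightarrow> real \<Rightarrow> complex).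
        inj_on p V \<and>
        (\<forall>e\<in>E. arc (\<gamma> e) \<and> {pathstart (\<gamma> e), pathfinish (\<gamma> e)} = p ` e) \<and>
        (\<forall>e\<in>E. \<forall>f\<in>E. e \<noteq> f \<longrightarrow>
            path_image (\<gamma> e) \<inter> path_image (\<gamma> f) \<subseteq> p ` (e \<inter> f)))"

text \<open>A straight-line drawing is determined by the positions \<open>p\<close> of the vertices.\<close>

definition planar_straight_line_drawing ::
    "'a set \<Rightarrow> 'a set set \<Rightarrow> ('a \<Rightarrow> complex) \<Rightarrow> bool" where
  "planar_straight_line_drawing V E p \<longleftrightarrow>
     inj_on p V \<and>
     (\<forall>u v x y. {u, v} \<in> E \<longrightarrow> {x, y} \<in> E \<longrightarrow> {u, v} \<noteq> {x, y} \<longrightarrow>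
        closed_segment (p u) (p v) \<inter> closed_segment (p x) (p y) \<subseteq> p ` ({u, v} \<inter> {x, y}))"

definition edge_length_ratio :: "'a set set \<Rightarrow> ('a \<Rightarrow> complex) \<Rightarrow> real" where
  "edge_length_ratio E p =
     Max {dist (p u) (p v) / dist (p x) (p y) | u v x y. {u, v} \<in> E \<and> {x, y} \<in> E}"

text \<open>
  The infimum is used because a minimum need not exist: for the complete bipartite graph
  \<open>K\<^sub>2\<^sub>,\<^sub>3\<close> the ratios come arbitrarily close to 1, but all edges having equal length would place
  three distinct points in the intersection of two circles with distinct centres.
\<close>

definition planar_edge_length_ratio :: "'a set \<Rightarrow> 'a set set \<Rightarrow> real" where
  "planar_edge_length_ratio V E =
     Inf {edge_length_ratio E p | p. planar_straight_line_drawing V E p}"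

end

theory Submission
  imports Defs
begin

text \<open>
  The graph is the cube of a path: \<open>i\<close> and \<open>j\<close> are adjacent if \<open>0 < \<bar>i - j\<bar> \<le> 3\<close>. In any planar
  straight-line drawing, the triangles on three consecutive vertices are nested along at least half
  of the path, starting at its middle and running towards one of its ends. Moving one step inwards
  replaces a vertex \<open>x\<close> of a triangle \<open>x y z\<close> by a point \<open>c\<close> of the triangle. As \<open>x\<close> is adjacent to
  \<open>y\<close>, \<open>z\<close> and \<open>c\<close>, all of these are at least the shortest edge length \<open>d\<close> away from \<open>x\<close>, which cuts
  off a corner: the perimeter drops by at least \<open>d / 2\<close> unless the angle at \<open>x\<close> is obtuse, and in
  that case the next replacement, at \<open>y\<close>, does so. Hence the perimeter of the outermost triangle is
  linear in the number of vertices.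
\<close>

subsection \<open>Perimeters of nested triangles\<close>

text \<open>If A is the smaller leg, the square of the right-hand side is A^2/4 + A B + B^2, and A B
  is at least A^2. This quantifies how much a right-angled shortcut saves.\<close>

lemma sqrt_sum_squares_le_half_min:
  fixes A B :: real
  assumes "0 \<le> A" "0 \<le> B"
  shows "sqrt (A\<^sup>2 + B\<^sup>2) \<le> A + B - min A B / 2"
proof (rule real_le_lsqrt)
  have "0 \<le> A * B" "A \<le> B \<Longrightarrow> A * A \<le> A * B" "B \<le> A \<Longrightarrow> B * B \<le> A * B"
    using assms by (auto intro: mult_left_mono mult_right_mono)
  then show "A\<^sup>2 + B\<^sup>2 \<le> (A + B - min A B / 2)\<^sup>2"
    by (auto simp: min_def power2_eq_square algebra_simps)
qed (use assms in \<open>auto simp: min_def\<close>)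

text \<open>At a non-obtuse angle the law of cosines gives at most the Pythagorean length, so the
  saving for a right angle is still available.\<close>

lemma norm_diff_scaleR_le:
  fixes u v :: "'a::real_inner"
  assumes "0 \<le> u \<bullet> v" "0 \<le> s" "0 \<le> t"
  shows "norm (s *\<^sub>R u - t *\<^sub>R v) \<le> s * norm u + t * norm v - min (s * norm u) (t * norm v) / 2"
proof -
  have "(norm (s *\<^sub>R u - t *\<^sub>R v))\<^sup>2 = (s * norm u)\<^sup>2 + (t * norm v)\<^sup>2 - 2 * (s * t) * (u \<bullet> v)"
    by (simp add: power2_norm_eq_inner inner_diff_left inner_diff_right inner_commute
        power_mult_distrib) (simp add: power2_eq_square algebra_simps)
  also have "\<dots> \<le> (s * norm u)\<^sup>2 + (t * norm v)\<^sup>2"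
    using assms by simp
  finally have "norm (s *\<^sub>R u - t *\<^sub>R v) \<le> sqrt ((s * norm u)\<^sup>2 + (t * norm v)\<^sup>2)"
    by (rule real_le_rsqrt)
  also have "\<dots> \<le> s * norm u + t * norm v - min (s * norm u) (t * norm v) / 2"
    by (rule sqrt_sum_squares_le_half_min) (use assms in auto)
  finally show ?thesis .
qed

text \<open>In the coordinates of c relative to x, the triangle inequality bounds each distance on
  the left by a combination of the two sides at x. In the sum, each side has total coefficient
  1.\<close>

lemma dist_sum_triangle_le:
  fixes x y z c :: "'a::real_inner"
  assumes "c \<in> convex hull {x, y, z}"
  shows "dist c y + dist c z \<le> dist x y + dist x z"
proof -
  obtain s t where st: "0 \<le> s" "0 \<le> t" "s + t \<le> 1"
    and c: "c = x + s *\<^sub>R (y - x) + t *\<^sub>R (z - x)"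
    using assms unfolding convex_hull_3_alt by auto
  have "c - y = t *\<^sub>R (z - x) - (1 - s) *\<^sub>R (y - x)" "c - z = s *\<^sub>R (y - x) - (1 - t) *\<^sub>R (z - x)"
    by (simp_all add: c algebra_simps)
  then have "dist c y \<le> t * dist x z + (1 - s) * dist x y"
    "dist c z \<le> s * dist x y + (1 - t) * dist x z"
    using norm_triangle_ineq4[of "t *\<^sub>R (z - x)" "(1 - s) *\<^sub>R (y - x)"]
      norm_triangle_ineq4[of "s *\<^sub>R (y - x)" "(1 - t) *\<^sub>R (z - x)"] st
    by (simp_all add: dist_norm norm_minus_commute)
  then show ?thesis by (simp add: algebra_simps)
qed

text \<open>The previous argument with both triangle inequalities sharpened by
  \<open>norm_diff_scaleR_le\<close>. The total saving is half of
  \<open>min q (a - p) + min p (b - q)\<close>, which turns out to be at least d.\<close>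

lemma dist_sum_triangle_le_nonobtuse:
  fixes x y z c :: "'a::real_inner"
  assumes c: "c \<in> convex hull {x, y, z}" and angle: "0 \<le> (y - x) \<bullet> (z - x)"
    and far: "d \<le> dist x y" "d \<le> dist x z" "d \<le> dist x c"
  shows "dist c y + dist c z \<le> dist x y + dist x z - d / 2"
proof -
  obtain s t where st: "0 \<le> s" "0 \<le> t" "s + t \<le> 1"
    and c: "c = x + s *\<^sub>R (y - x) + t *\<^sub>R (z - x)"
    using assms unfolding convex_hull_3_alt by auto
  define a b p q where "a = dist x y" and "b = dist x z" and "p = s * a" and "q = t * b"
  have ab: "norm (y - x) = a" "norm (z - x) = b" "0 \<le> a" "0 \<le> b"
    by (auto simp: a_def b_def dist_norm norm_minus_commute)
  have c1: "dist c y = norm (t *\<^sub>R (z - x) - (1 - s) *\<^sub>R (y - x))"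
    and c2: "dist c z = norm (s *\<^sub>R (y - x) - (1 - t) *\<^sub>R (z - x))"
    by (simp_all add: c dist_norm algebra_simps)
  have "(1 - s) * a = a - p" "(1 - t) * b = b - q"
    by (simp_all add: p_def q_def algebra_simps)
  then have 1: "dist c y \<le> q + (a - p) - min q (a - p) / 2"
    and 2: "dist c z \<le> p + (b - q) - min p (b - q) / 2"
    using norm_diff_scaleR_le[of "z - x" "y - x" t "1 - s"]
      norm_diff_scaleR_le[of "y - x" "z - x" s "1 - t"] st angle
    by (simp_all add: c1 c2 ab p_def q_def inner_commute del: diff_ge_0_iff_ge)
  have "dist x c = norm (s *\<^sub>R (y - x) + t *\<^sub>R (z - x))"
    by (simp add: c dist_norm norm_minus_commute algebra_simps)
  also have "\<dots> \<le> p + q"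
    using norm_triangle_ineq[of "s *\<^sub>R (y - x)" "t *\<^sub>R (z - x)"] st by (simp add: ab p_def q_def)
  finally have pq: "d \<le> p + q" using far by simp
  have "p + q \<le> max a b"
  proof -
    have "p + q \<le> s * max a b + t * max a b"
      unfolding p_def q_def by (intro add_mono mult_left_mono) (use st in auto)
    also have "\<dots> = (s + t) * max a b" by (simp add: algebra_simps)
    also have "\<dots> \<le> max a b"
      by (rule mult_left_le_one_le) (use st ab in auto)
    finally show ?thesis .
  qed
  \<comment> \<open>Four cases according to the two minima: the sum is p + q, a, b, or a + b - (p +
    q). The last is at least min a b because p + q is at most max a b.\<close>
  then have "d \<le> min q (a - p) + min p (b - q)"
    using far pq by (auto simp: min_def max_def a_def[symmetric] b_def[symmetric] split: if_splits)
  with 1 2 show ?thesis by (simp add: a_def[symmetric] b_def[symmetric])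
qed

text \<open>An obtuse angle at the removed vertex \<open>x\<close> costs one step: replacing \<open>x\<close> by \<open>c\<close>
  leaves a triangle whose angle at the next removed vertex \<open>y\<close> is not obtuse.\<close>

lemma nonobtuse_after_replacement:
  fixes x y z c :: "'a::real_inner"
  assumes "c \<in> convex hull {x, y, z}" and "(y - x) \<bullet> (z - x) < 0"
  shows "0 \<le> (z - y) \<bullet> (c - y)"
proof -
  obtain u v w where st: "0 \<le> u" "0 \<le> v" "0 \<le> w" "u + v + w = 1"
    and c: "c = u *\<^sub>R x + v *\<^sub>R y + w *\<^sub>R z"
    using assms unfolding convex_hull_3 by auto
  \<comment> \<open>The last summand vanishes; it makes the identity hold before the weights are
    known to sum to 1.\<close>
  have "c - y = u *\<^sub>R (x - y) + w *\<^sub>R (z - y) + (u + v + w - 1) *\<^sub>R y"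
    by (simp add: c algebra_simps)
  then have "(z - y) \<bullet> (c - y) = u * ((z - y) \<bullet> (x - y)) + w * ((z - y) \<bullet> (z - y))"
    using st by (simp add: inner_add_right)
  moreover have "(z - y) \<bullet> (x - y) = (x - y) \<bullet> (x - y) - (y - x) \<bullet> (z - x)"
    by (simp add: inner_diff_left inner_diff_right inner_commute algebra_simps)
  moreover have "0 \<le> (x - y) \<bullet> (x - y) - (y - x) \<bullet> (z - x)"
    using inner_ge_zero[of "x - y"] assms(2) by linarith
  ultimately show ?thesis using st(1,3) by simp
qed

definition perimeter :: "(nat \<Rightarrow> 'a::metric_space) \<Rightarrow> nat \<Rightarrow> real" where
  "perimeter w j = dist (w j) (w (j+1)) + dist (w (j+1)) (w (j+2)) + dist (w j) (w (j+2))"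

text \<open>The window moves from \<open>w j\<close> to \<open>w (j+3)\<close>; the side between the
  two retained vertices cancels.\<close>

lemma perimeter_nested_step:
  fixes w :: "nat \<Rightarrow> 'a::real_inner"
  assumes "w (j+3) \<in> convex hull {w j, w (j+1), w (j+2)}"
  shows "perimeter w (j+1) \<le> perimeter w j"
  using dist_sum_triangle_le[OF assms]
  by (simp add: perimeter_def numeral_eq_Suc dist_commute)

lemma perimeter_nested_step_nonobtuse:
  fixes w :: "nat \<Rightarrow> 'a::real_inner"
  assumes "w (j+3) \<in> convex hull {w j, w (j+1), w (j+2)}"
    and "0 \<le> (w (j+1) - w j) \<bullet> (w (j+2) - w j)"
    and "\<And>i. j < i \<Longrightarrow> i \<le> j + 3 \<Longrightarrow> d \<le> dist (w j) (w i)"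
  shows "perimeter w (j+1) \<le> perimeter w j - d / 2"
  using dist_sum_triangle_le_nonobtuse[OF assms(1,2), of d] assms(3)[of "j+1"] assms(3)[of "j+2"]
    assms(3)[of "j+3"]
  by (simp add: perimeter_def numeral_eq_Suc dist_commute)

text \<open>If the angle at \<open>w j\<close> is not obtuse, the first step gains d/2; otherwise
  the angle at \<open>w (j+1)\<close> in the new triangle is not obtuse and the second step gains
  it. The other step never increases the perimeter.\<close>

lemma perimeter_nested_two_steps:
  fixes w :: "nat \<Rightarrow> 'a::real_inner"
  assumes in1: "w (j+3) \<in> convex hull {w j, w (j+1), w (j+2)}"
    and in2: "w (j+4) \<in> convex hull {w (j+1), w (j+2), w (j+3)}"
    and far: "\<And>i i'. i < i' \<Longrightarrow> i' \<le> i + 3 \<Longrightarrow> i' \<le> j + 4 \<Longrightarrow> d \<le> dist (w i) (w i')"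
  shows "perimeter w (j+2) \<le> perimeter w j - d / 2"
proof (cases "0 \<le> (w (j+1) - w j) \<bullet> (w (j+2) - w j)")
  case True
  have "perimeter w (j+1) \<le> perimeter w j - d / 2"
    by (rule perimeter_nested_step_nonobtuse[OF in1 True]) (rule far, auto)
  moreover have "perimeter w (j+1+1) \<le> perimeter w (j+1)"
    by (rule perimeter_nested_step) (use in2 in \<open>simp add: numeral_eq_Suc\<close>)
  ultimately show ?thesis by simp
next
  case False
  then have "0 \<le> (w (j+2) - w (j+1)) \<bullet> (w (j+3) - w (j+1))"
    using nonobtuse_after_replacement[OF in1] by simp
  then have "perimeter w (j+1+1) \<le> perimeter w (j+1) - d / 2"
    using in2
    by (intro perimeter_nested_step_nonobtuse far) (auto simp: numeral_eq_Suc)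
  then show ?thesis using perimeter_nested_step[OF in1] by simp
qed

lemma perimeter_nested_chain:
  fixes w :: "nat \<Rightarrow> 'a::real_inner"
  assumes "\<And>j. j < s \<Longrightarrow> w (j+3) \<in> convex hull {w j, w (j+1), w (j+2)}"
    and "\<And>i i'. i < i' \<Longrightarrow> i' \<le> i + 3 \<Longrightarrow> i' < s + 3 \<Longrightarrow> d \<le> dist (w i) (w i')"
  shows "3 * d + real (s div 2) * (d / 2) \<le> perimeter w 0"
proof -
  have "perimeter w (2 * i) + real i * (d / 2) \<le> perimeter w 0" if "2 * i \<le> s" for i
    using that
  proof (induction i)
    case (Suc i)
    have "perimeter w (2 * i + 2) \<le> perimeter w (2 * i) - d / 2"
      by (rule perimeter_nested_two_steps)
        (use assms(1)[of "2 * i"] assms(1)[of "2 * i + 1"] assms(2) Suc.prems in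
          \<open>auto simp: numeral_eq_Suc\<close>)
    with Suc show ?case by (simp add: field_simps)
  qed simp
  from this[of "s div 2"] have "perimeter w (2 * (s div 2)) + real (s div 2) * (d / 2) \<le> perimeter w 0"
    by simp
  moreover have "2 * (s div 2) \<le> s" by simp
  \<comment> \<open>The innermost triangle reached still has three sides of length at least
    d.\<close>
  then have "3 * d \<le> perimeter w (2 * (s div 2))"
    unfolding perimeter_def
    using assms(2)[of "2 * (s div 2)" "2 * (s div 2) + 1"] assms(2)[of "2 * (s div 2)" "2 * (s div 2) + 2"]
      assms(2)[of "2 * (s div 2) + 1" "2 * (s div 2) + 2"] by linarith
  ultimately show ?thesis by simp
qed

subsection \<open>Triangles in the plane\<close>

text \<open>Four points of the plane have a Radon partition. A split into two pairs would make two
  opposite segments cross, so one point lies in the hull of the other three.\<close>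

lemma convex_hull_4_Radon:
  fixes a b c d :: complex
  assumes "distinct [a, b, c, d]"
    and disj: "closed_segment a b \<inter> closed_segment c d = {}"
      "closed_segment a c \<inter> closed_segment b d = {}"
      "closed_segment a d \<inter> closed_segment b c = {}"
  shows "a \<in> convex hull {b, c, d} \<or> b \<in> convex hull {a, c, d} \<or>
    c \<in> convex hull {a, b, d} \<or> d \<in> convex hull {a, b, c}"
proof -
  have "affine_dependent {a, b, c, d}"
    by (rule affine_dependent_biggerset) (use assms(1) in auto)
  then obtain M P where MP: "M \<inter> P = {}" "M \<union> P = {a, b, c, d}"
      "convex hull M \<inter> convex hull P \<noteq> {}"
    using Radon_partition[of "{a, b, c, d}"] by auto
  have "P = {a, b, c, d} - M" "M \<in> Pow {a, b, c, d}" using MP by auto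
  then show ?thesis
    using MP(3) assms(1) disj
    by (auto simp: Pow_insert insert_Diff_if segment_convex_hull insert_commute)
qed

text \<open>A connected set that meets the triangle but not its frontier cannot leave it.\<close>

lemma connected_subset_interior_triangle:
  fixes a b c :: complex
  assumes "connected S" "S \<inter> convex hull {a, b, c} \<noteq> {}"
    and "S \<inter> (closed_segment a b \<union> closed_segment b c \<union> closed_segment c a) = {}"
  shows "S \<subseteq> interior (convex hull {a, b, c})"
proof -
  have fr: "frontier (convex hull {a, b, c}) = closed_segment a b \<union> closed_segment b c \<union> closed_segment c a"
    by (rule frontier_of_triangle) simp
  then have "S \<subseteq> convex hull {a, b, c}"
    using connected_Int_frontier[OF assms(1,2)] assms(3) by auto
  then show ?thesis
    using assms(3) fr by (auto simp: interior_of_triangle)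
qed

lemma affine_independent_triangle:
  fixes a b c :: complex
  assumes "interior (convex hull {a, b, c}) \<noteq> {}"
  shows "distinct [a, b, c]" "\<not> affine_dependent {a, b, c}"
proof -
  have "\<not> collinear {a, b, c}"
    using assms aff_dim_nonempty_interior[of "convex hull {a, b, c}"]
    by (auto simp: collinear_aff_dim aff_dim_convex_hull)
  then show "distinct [a, b, c]" "\<not> affine_dependent {a, b, c}"
    by (auto simp: collinear_3_eq_affine_dependent)
qed

text \<open>Removing the extreme point b from the triangle leaves a convex set, which contains a, c
  and d and hence their hull.\<close>

lemma vertex_not_in_subtriangle:
  fixes a b c d :: complex
  assumes "d \<in> interior (convex hull {a, b, c})"
  shows "b \<notin> convex hull {a, c, d}"
proof
  assume b: "b \<in> convex hull {a, c, d}"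
  have "b extreme_point_of (convex hull {a, b, c})"
    using affine_independent_triangle[of a b c] assms
    by (metis emptyE extreme_point_of_convex_hull_affine_independent insertCI)
  then have "convex (convex hull {a, b, c} - {b})"
    by (simp add: extreme_point_of_stillconvex)
  moreover have "{a, c, d} \<subseteq> convex hull {a, b, c} - {b}"
    using affine_independent_triangle[of a b c] assms not_in_interior_convex_hull_3(2)[of b a c]
      interior_subset[of "convex hull {a, b, c}"]
    by (auto simp: hull_inc)
  ultimately have "convex hull {a, c, d} \<subseteq> convex hull {a, b, c} - {b}"
    by (simp add: hull_minimal)
  with b show False by auto
qed

text \<open>The segment from w to d keeps both points inside abc, so w lies in one of the three
  subtriangles at d. In the two wrong ones, the segment from w to b or c could not get out, and
  would place that corner inside a subtriangle avoiding it.\<close>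

lemma stacked_vertex_in_subtriangle:
  fixes a b c d w :: complex
  assumes d: "d \<in> convex hull {a, b, c}"
    and wd: "closed_segment w d \<inter> (closed_segment a b \<union> closed_segment b c \<union> closed_segment c a) = {}"
    and wb: "closed_segment w b \<inter> (closed_segment a c \<union> closed_segment c d \<union> closed_segment d a) = {}"
    and wc: "closed_segment w c \<inter> (closed_segment a b \<union> closed_segment b d \<union> closed_segment d a) = {}"
  shows "w \<in> convex hull {b, c, d}"
proof -
  have "closed_segment w d \<subseteq> interior (convex hull {a, b, c})"
    by (rule connected_subset_interior_triangle) (use d wd in auto)
  then have int: "w \<in> interior (convex hull {a, b, c})" "d \<in> interior (convex hull {a, b, c})"
    by auto
  then have "w \<in> convex hull {a, b, c}"
    using interior_subset by auto
  then obtain v where v: "v \<in> {a, b, c}" "w \<in> convex hull (insert d ({a, b, c} - {v}))"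
    using in_convex_hull_exchange[OF d] by blast
  have dist: "distinct [a, b, c]"
    using affine_independent_triangle(1)[of a b c] int by blast
  consider "v = a" | "v = b" | "v = c" using v by auto
  then show ?thesis
  proof cases
    case 1
    then show ?thesis using v dist by (auto simp: insert_Diff_if insert_commute split: if_splits)
  next
    case 2
    then have "w \<in> convex hull {a, c, d}"
      using v dist by (auto simp: insert_Diff_if insert_commute split: if_splits)
    then have "closed_segment w b \<subseteq> interior (convex hull {a, c, d})"
      by (intro connected_subset_interior_triangle wb) auto
    then have "b \<in> convex hull {a, c, d}" using interior_subset by auto
    then show ?thesis using vertex_not_in_subtriangle int by blast
  next
    case 3
    then have "w \<in> convex hull {a, b, d}"
      using v dist by (auto simp: insert_Diff_if insert_commute split: if_splits)
    then have "closed_segment w c \<subseteq> interior (convex hull {a, b, d})"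
      by (intro connected_subset_interior_triangle wc) auto
    then have "c \<in> convex hull {a, b, d}" using interior_subset by auto
    moreover have "c \<notin> convex hull {a, b, d}"
      by (rule vertex_not_in_subtriangle) (use int in \<open>simp add: insert_commute\<close>)
    ultimately show ?thesis by blast
  qed
qed

text \<open>The exchange of d for corners of an affinely independent triangle is unique, so the
  hulls of d with {a} and of d with {b, c} share only the hull of d.\<close>

lemma segment_to_vertex_Int_opposite:
  fixes a b c d :: complex
  assumes d: "d \<in> interior (convex hull {a, b, c})"
  shows "closed_segment d a \<inter> convex hull {b, c, d} = {d}"
proof -
  have aff: "\<not> affine_dependent {a, b, c}" "distinct [a, b, c]"
    using affine_independent_triangle[of a b c] d by blast+
  have "x = d" if "x \<in> convex hull (insert d {a})" "x \<in> convex hull (insert d {b, c})" for x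
    using in_convex_hull_exchange_unique[OF aff(1) _ _ _ that] d interior_subset aff(2) by fastforce
  then show ?thesis
    by (auto simp: segment_convex_hull insert_commute hull_inc)
qed

lemma segment_to_vertex_interior:
  fixes a b c d :: complex
  assumes "d \<in> interior (convex hull {a, b, c})"
  shows "closed_segment d a - {a} \<subseteq> interior (convex hull {a, b, c})"
proof -
  have "open_segment d a \<subseteq> interior (convex hull {a, b, c})"
    by (rule in_interior_closure_convex_segment[OF _ assms])
      (auto intro: subsetD[OF closure_subset] hull_inc)
  then show ?thesis
    using assms by (auto simp: open_segment_def)
qed

lemma centroid_in_interior:
  fixes a b c :: complex
  assumes "interior (convex hull {a, b, c}) \<noteq> {}"
  shows "(1/3) *\<^sub>R (a + b + c) \<in> interior (convex hull {a, b, c})"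
    and "interior (convex hull {b, c, (1/3) *\<^sub>R (a + b + c)}) \<noteq> {}"
proof -
  have nc: "\<not> collinear {a, b, c}"
    using affine_independent_triangle[OF assms] by (auto simp: collinear_3_eq_affine_dependent)
  show "(1/3) *\<^sub>R (a + b + c) \<in> interior (convex hull {a, b, c})"
    unfolding interior_convex_hull_3_minimal[OF nc DIM_complex]
    by (auto intro!: exI[of _ "1/3"] simp: scaleR_right_distrib)
  have "\<not> collinear {b, c, (1/3) *\<^sub>R (a + b + c)}"
  proof
    assume "collinear {b, c, (1/3) *\<^sub>R (a + b + c)}"
    then have "collinear {b, (1/3) *\<^sub>R (a + b + c), c}" by (simp add: insert_commute)
    then obtain u where "b = c \<or> (1/3) *\<^sub>R (a + b + c) = u *\<^sub>R b + (1 - u) *\<^sub>R c"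
      unfolding collinear_3_expand by auto
    \<comment> \<open>Solving for a shows that a would lie on the line through b and c.\<close>
    then have "b = c \<or> a = (3 * u - 1) *\<^sub>R b + (1 - (3 * u - 1)) *\<^sub>R c"
      by (auto simp: complex_eq_iff field_simps)
    then have "collinear {b, a, c}" unfolding collinear_3_expand by blast
    then show False using nc by (simp add: insert_commute)
  qed
  note interior_convex_hull_3_minimal[OF this DIM_complex]
  then have "(1/3) *\<^sub>R b + (1/3) *\<^sub>R c + (1/3) *\<^sub>R ((1/3) *\<^sub>R (a + b + c))
      \<in> interior (convex hull {b, c, (1/3) *\<^sub>R (a + b + c)})"
    by (force intro!: exI[of _ "1/3"])
  then show "interior (convex hull {b, c, (1/3) *\<^sub>R (a + b + c)}) \<noteq> {}"
    by blast
qed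

subsection \<open>Drawings of the cube of a path\<close>

text \<open>Four consecutive vertices form a complete graph, and the graph grows at either end by
  joining a new vertex to the last three.\<close>

definition path_cube :: "nat \<Rightarrow> nat set set" where
  "path_cube n = {{i, j} | i j. i < j \<and> j \<le> i + 3 \<and> j < n}"

lemma path_cube_edge_iff:
  "{i, j} \<in> path_cube n \<longleftrightarrow> i \<noteq> j \<and> i \<le> j + 3 \<and> j \<le> i + 3 \<and> i < n \<and> j < n"
proof -
  have "{i, j} \<in> path_cube n \<longleftrightarrow> (\<exists>i' j'. {i, j} = {i', j'} \<and> i' < j' \<and> j' \<le> i' + 3 \<and> j' < n)"
    by (simp add: path_cube_def)
  also have "\<dots> \<longleftrightarrow> (i < j \<and> j \<le> i + 3 \<and> j < n) \<or> (j < i \<and> i \<le> j + 3 \<and> i < n)"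
    by (auto simp: doubleton_eq_iff)
  also have "\<dots> \<longleftrightarrow> i \<noteq> j \<and> i \<le> j + 3 \<and> j \<le> i + 3 \<and> i < n \<and> j < n"
    by auto
  finally show ?thesis .
qed

lemma simple_graph_path_cube: "simple_graph {..<n} (path_cube n)"
  by (auto simp: simple_graph_def path_cube_def)

lemma drawing_disjoint_edges:
  assumes "planar_straight_line_drawing V E p" "{u, v} \<in> E" "{x, y} \<in> E" "{u, v} \<inter> {x, y} = {}"
  shows "closed_segment (p u) (p v) \<inter> closed_segment (p x) (p y) = {}"
proof -
  have "{u, v} \<noteq> {x, y}" using assms(4) by auto
  then show ?thesis
    using assms unfolding planar_straight_line_drawing_def by fastforce
qed

lemma drawing_K4:
  assumes p: "planar_straight_line_drawing V E p" and "distinct [a, b, c, d]" "{a, b, c, d} \<subseteq> V"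
    and E: "{a, b} \<in> E" "{a, c} \<in> E" "{a, d} \<in> E" "{b, c} \<in> E" "{b, d} \<in> E" "{c, d} \<in> E"
  shows "p a \<in> convex hull {p b, p c, p d} \<or> p b \<in> convex hull {p a, p c, p d} \<or>
    p c \<in> convex hull {p a, p b, p d} \<or> p d \<in> convex hull {p a, p b, p c}"
proof (rule convex_hull_4_Radon)
  have "inj_on p {a, b, c, d}"
    using p inj_on_subset[OF _ assms(3)] unfolding planar_straight_line_drawing_def by blast
  then show "distinct [p a, p b, p c, p d]"
    using assms(2) by (auto simp: inj_on_def)
qed (rule drawing_disjoint_edges[OF p]; use assms in auto)+

text \<open>Each edge at w is vertex-disjoint from the triangle on the other three vertices of the
  K4, so planarity supplies all the avoidance conditions.\<close>

lemma drawing_stacked_vertex: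
  assumes p: "planar_straight_line_drawing V E p" and dist: "distinct [a, b, c, d, w]"
    and E: "{a, b} \<in> E" "{a, c} \<in> E" "{a, d} \<in> E" "{b, c} \<in> E" "{b, d} \<in> E" "{c, d} \<in> E"
      "{w, b} \<in> E" "{w, c} \<in> E" "{w, d} \<in> E"
    and d: "p d \<in> convex hull {p a, p b, p c}"
  shows "p w \<in> convex hull {p b, p c, p d}"
proof (rule stacked_vertex_in_subtriangle[OF d])
  show "closed_segment (p w) (p d) \<inter> (closed_segment (p a) (p b) \<union> closed_segment (p b) (p c)
      \<union> closed_segment (p c) (p a)) = {}"
    unfolding Int_Un_distrib Un_empty
    by (intro conjI drawing_disjoint_edges[OF p]) (use E dist in \<open>auto simp: insert_commute\<close>)
  show "closed_segment (p w) (p b) \<inter> (closed_segment (p a) (p c) \<union> closed_segment (p c) (p d)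
      \<union> closed_segment (p d) (p a)) = {}"
    unfolding Int_Un_distrib Un_empty
    by (intro conjI drawing_disjoint_edges[OF p]) (use E dist in \<open>auto simp: insert_commute\<close>)
  show "closed_segment (p w) (p c) \<inter> (closed_segment (p a) (p b) \<union> closed_segment (p b) (p d)
      \<union> closed_segment (p d) (p a)) = {}"
    unfolding Int_Un_distrib Un_empty
    by (intro conjI drawing_disjoint_edges[OF p]) (use E dist in \<open>auto simp: insert_commute\<close>)
qed

text \<open>The vertex i+4 is stacked on the last three, whichever of them is the inner one of the
  K4. The conclusion is the third alternative for i+1, so the argument iterates.\<close>

lemma path_cube_nesting_propagates_up:
  assumes p: "planar_straight_line_drawing {..<n} (path_cube n) p" and "i + 4 < n"
    and "p (i+1) \<in> convex hull {p i, p (i+2), p (i+3)} \<or>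
      p (i+2) \<in> convex hull {p i, p (i+1), p (i+3)} \<or>
      p (i+3) \<in> convex hull {p i, p (i+1), p (i+2)}"
  shows "p (i+4) \<in> convex hull {p (i+1), p (i+2), p (i+3)}"
  using assms(3)
proof (elim disjE)
  assume "p (i+1) \<in> convex hull {p i, p (i+2), p (i+3)}"
  then have "p (i+4) \<in> convex hull {p (i+2), p (i+3), p (i+1)}"
    by (intro drawing_stacked_vertex[OF p, of i "i+2" "i+3" "i+1" "i+4"])
      (use assms(2) in \<open>simp_all add: path_cube_edge_iff insert_commute\<close>)
  then show ?thesis by (simp add: insert_commute)
next
  assume "p (i+2) \<in> convex hull {p i, p (i+1), p (i+3)}"
  then have "p (i+4) \<in> convex hull {p (i+1), p (i+3), p (i+2)}"
    by (intro drawing_stacked_vertex[OF p, of i "i+1" "i+3" "i+2" "i+4"])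
      (use assms(2) in \<open>simp_all add: path_cube_edge_iff insert_commute\<close>)
  then show ?thesis by (simp add: insert_commute)
next
  assume "p (i+3) \<in> convex hull {p i, p (i+1), p (i+2)}"
  then show ?thesis
    by (intro drawing_stacked_vertex[OF p, of i "i+1" "i+2" "i+3" "i+4"])
      (use assms(2) in \<open>simp_all add: path_cube_edge_iff insert_commute\<close>)
qed

text \<open>The mirror image: i+4 is the corner not joined to the new vertex i. The conclusion has
  the shape of the hypothesis one index lower.\<close>

lemma path_cube_nesting_propagates_down:
  assumes p: "planar_straight_line_drawing {..<n} (path_cube n) p" and "i + 4 < n"
    and "p (i+1) \<in> convex hull {p (i+2), p (i+3), p (i+4)}"
  shows "p i \<in> convex hull {p (i+1), p (i+2), p (i+3)}"
proof -
  have "p i \<in> convex hull {p (i+2), p (i+3), p (i+1)}"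
    using assms(3)
    by (intro drawing_stacked_vertex[OF p, of "i+4" "i+2" "i+3" "i+1" i])
      (use assms(2) in \<open>simp_all add: path_cube_edge_iff insert_commute\<close>)
  then show ?thesis by (simp add: insert_commute)
qed

text \<open>The inner vertex of the K4 on m, ..., m+3 decides the direction. The size 2m+4 puts this
  K4 in the middle, leaving m vertices on either side.\<close>

lemma path_cube_nested_chain:
  assumes p: "planar_straight_line_drawing {..<n} (path_cube n) p" and n: "n = 2 * m + 4"
  shows "\<exists>f. (\<forall>j<m. p (f (j+3)) \<in> convex hull {p (f j), p (f (j+1)), p (f (j+2))}) \<and>
    (\<forall>i j. i < j \<longrightarrow> j \<le> i + 3 \<longrightarrow> j < m + 3 \<longrightarrow> {f i, f j} \<in> path_cube n)"
proof (cases "p m \<in> convex hull {p (m+1), p (m+2), p (m+3)}")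
  case True
  have down: "p (m-j) \<in> convex hull {p (m-j+1), p (m-j+2), p (m-j+3)}" if "j \<le> m" for j
    using that
  proof (induction j)
    case (Suc j)
    then have "m - j = Suc (m - Suc j)" by simp
    with Suc show ?case
      using path_cube_nesting_propagates_down[OF p, of "m - Suc j"] n
      by (simp add: numeral_eq_Suc)
  qed (use True in simp)
  show ?thesis
  proof (intro exI conjI allI impI)
    fix j assume "j < m"
    \<comment> \<open>The chain is \<open>f j = m + 3 - j\<close>, running towards vertex 0.\<close>
    then show "p (m + 3 - (j+3)) \<in> convex hull {p (m+3-j), p (m+3-(j+1)), p (m+3-(j+2))}"
      using down[of j] by (simp add: insert_commute numeral_eq_Suc Suc_diff_le)
  next
    fix i j assume "i < j" "j \<le> i + 3" "j < m + 3"
    then show "{m + 3 - i, m + 3 - j} \<in> path_cube n"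
      using n by (auto simp: path_cube_edge_iff)
  qed
next
  case False
  have K4: "p m \<in> convex hull {p (m+1), p (m+2), p (m+3)} \<or>
      p (m+1) \<in> convex hull {p m, p (m+2), p (m+3)} \<or>
      p (m+2) \<in> convex hull {p m, p (m+1), p (m+3)} \<or>
      p (m+3) \<in> convex hull {p m, p (m+1), p (m+2)}"
    by (rule drawing_K4[OF p]) (use n in \<open>auto simp: path_cube_edge_iff\<close>)
  have up: "p (m+1+j+3) \<in> convex hull {p (m+1+j), p (m+1+j+1), p (m+1+j+2)}" if "j < m" for j
    using that
  proof (induction j)
    \<comment> \<open>Any of m+1, m+2, m+3 may be the inner vertex here, so the chain
      \<open>f j = m + 1 + j\<close> starts only after one propagation step.\<close>
    case 0
    then show ?case
      using path_cube_nesting_propagates_up[OF p, of m] K4 False n by (simp add: numeral_eq_Suc)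
  next
    case (Suc j)
    then show ?case
      using path_cube_nesting_propagates_up[OF p, of "m+1+j"] n by (simp add: numeral_eq_Suc)
  qed
  show ?thesis
  proof (intro exI conjI allI impI)
    fix j assume "j < m"
    then show "p (m+1+(j+3)) \<in> convex hull {p (m+1+j), p (m+1+(j+1)), p (m+1+(j+2))}"
      using up[of j] by (simp add: add.assoc)
  next
    fix i j assume "i < j" "j \<le> i + 3" "j < m + 3"
    then show "{m + 1 + i, m + 1 + j} \<in> path_cube n"
      using n by (auto simp: path_cube_edge_iff)
  qed
qed

section \<open>The edge-length ratio of an arbitrary drawing\<close>

lemma edge_length_ratio_ge:
  assumes "simple_graph V E" "{u, v} \<in> E" "{x, y} \<in> E"
  shows "dist (p u) (p v) / dist (p x) (p y) \<le> edge_length_ratio E p"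
  unfolding edge_length_ratio_def
proof (rule Max_ge)
  let ?r = "\<lambda>(u, v, x, y). dist (p u) (p v) / dist (p x) (p y)"
  \<comment> \<open>Covering the ratios by an image of the finite set V^4 makes \<open>Max\<close>
    meaningful.\<close>
  have "{dist (p u) (p v) / dist (p x) (p y) |u v x y. {u, v} \<in> E \<and> {x, y} \<in> E}
      \<subseteq> ?r ` (V \<times> V \<times> V \<times> V)"
  proof clarify
    fix u v x y assume "{u, v} \<in> E" "{x, y} \<in> E"
    then have "{u, v} \<subseteq> V" "{x, y} \<subseteq> V" using assms(1) unfolding simple_graph_def by blast+
    then show "dist (p u) (p v) / dist (p x) (p y) \<in> ?r ` (V \<times> V \<times> V \<times> V)"
      by (intro image_eqI[of _ _ "(u, v, x, y)"]) auto
  qed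
  moreover have "finite V" using assms(1) by (simp add: simple_graph_def)
  ultimately show "finite {dist (p u) (p v) / dist (p x) (p y) |u v x y. {u, v} \<in> E \<and> {x, y} \<in> E}"
    by (meson finite_SigmaI finite_imageI finite_subset)
qed (use assms in auto)

lemma shortest_edge:
  assumes "simple_graph V E" "E \<noteq> {}"
  obtains x y where "{x, y} \<in> E" "\<And>u v. {u, v} \<in> E \<Longrightarrow> dist (p x) (p y) \<le> dist (p u) (p v)"
proof -
  let ?S = "{(u, v). {u, v} \<in> E}"
  have "?S \<subseteq> V \<times> V" "finite V"
    using assms(1) by (auto simp: simple_graph_def)
  then have "finite ?S" by (meson finite_SigmaI finite_subset)
  moreover have "?S \<noteq> {}"
    using assms by (force simp: simple_graph_def card_2_iff)
  ultimately obtain e where "e \<in> ?S" "\<And>f. f \<in> ?S \<Longrightarrow> dist (p (fst e)) (p (snd e)) \<le> dist (p (fst f)) (p (snd f))"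
    using ex_is_arg_min_if_finite[of ?S "\<lambda>e. dist (p (fst e)) (p (snd e))"]
    unfolding is_arg_min_def by (metis linorder_not_less)
  then show ?thesis
    using that[of "fst e" "snd e"] by fastforce
qed

text \<open>With d the shortest edge length, the sides of the outermost triangle are edges, each at
  most the ratio times d. Compare three times this with the perimeter bound and divide by
  3d.\<close>

lemma path_cube_edge_length_ratio:
  assumes p: "planar_straight_line_drawing {..<n} (path_cube n) p" and n: "n = 2 * m + 4"
  shows "1 + real (m div 2) / 6 \<le> edge_length_ratio (path_cube n) p"
proof -
  have "{0, 1} \<in> path_cube n" using n by (simp add: path_cube_edge_iff)
  then obtain x y where xy: "{x, y} \<in> path_cube n"
    and short: "\<And>u v. {u, v} \<in> path_cube n \<Longrightarrow> dist (p x) (p y) \<le> dist (p u) (p v)"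
    using shortest_edge[OF simple_graph_path_cube, of n p] by blast
  define d where "d = dist (p x) (p y)"
  have d: "d > 0"
    using p xy by (auto simp: d_def planar_straight_line_drawing_def inj_on_def path_cube_edge_iff)
  obtain f where nest: "\<And>j. j < m \<Longrightarrow> p (f (j+3)) \<in> convex hull {p (f j), p (f (j+1)), p (f (j+2))}"
    and edge: "\<And>i j. i < j \<Longrightarrow> j \<le> i + 3 \<Longrightarrow> j < m + 3 \<Longrightarrow> {f i, f j} \<in> path_cube n"
    using path_cube_nested_chain[OF p n] by metis
  have "3 * d + real (m div 2) * (d / 2) \<le> perimeter (p \<circ> f) 0"
    by (rule perimeter_nested_chain) (use nest in \<open>auto simp: d_def intro!: short edge\<close>)
  moreover have "dist (p (f i)) (p (f j)) \<le> edge_length_ratio (path_cube n) p * d"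
    if "i < j" "j < 3" for i j
    using edge_length_ratio_ge[OF simple_graph_path_cube, of "f i" "f j" n x y p] edge[of i j] that xy d
    by (simp add: d_def[symmetric] field_simps)
  from this[of 0 1] this[of 1 2] this[of 0 2]
  have "perimeter (p \<circ> f) 0 \<le> 3 * edge_length_ratio (path_cube n) p * d"
    by (simp add: perimeter_def numeral_eq_Suc)
  ultimately have "(3 + real (m div 2) / 2) * d \<le> (3 * edge_length_ratio (path_cube n) p) * d"
    by (simp add: algebra_simps)
  then show ?thesis using d by simp
qed

subsection \<open>A planar drawing by successive centroids\<close>

fun stacked_point :: "nat \<Rightarrow> complex" where
  "stacked_point 0 = 0"
| "stacked_point (Suc 0) = 1"
| "stacked_point (Suc (Suc 0)) = \<i>"
| "stacked_point (Suc (Suc (Suc n))) =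
     (1/3) *\<^sub>R (stacked_point n + stacked_point (Suc n) + stacked_point (Suc (Suc n)))"

definition stacked_triangle :: "nat \<Rightarrow> complex set" where
  "stacked_triangle i = convex hull {stacked_point i, stacked_point (i+1), stacked_point (i+2)}"

lemma interior_stacked_triangle: "interior (stacked_triangle i) \<noteq> {}"
proof (induction i)
  case 0
  have nc: "\<not> collinear {0, 1, \<i>}"
    by (auto simp: collinear_lemma complex_eq_iff)
  have "(1/3) *\<^sub>R 0 + (1/3) *\<^sub>R 1 + (1/3) *\<^sub>R \<i> \<in> interior (convex hull {0, 1, \<i>})"
    unfolding interior_convex_hull_3_minimal[OF nc DIM_complex] by (force intro!: exI[of _ "1/3"])
  then show ?case
    by (auto simp: stacked_triangle_def numeral_eq_Suc)
next
  case (Suc i)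
  then show ?case
    using centroid_in_interior(2)[of "stacked_point i" "stacked_point (i+1)" "stacked_point (i+2)"]
    by (simp add: stacked_triangle_def numeral_eq_Suc)
qed

lemma stacked_point_in_interior: "stacked_point (i+3) \<in> interior (stacked_triangle i)"
  using centroid_in_interior(1) interior_stacked_triangle[of i]
  by (simp add: stacked_triangle_def numeral_eq_Suc)

lemma stacked_edge_interior:
  assumes "a < i + 3" "i \<le> a"
  shows "closed_segment (stacked_point (i+3)) (stacked_point a) - {stacked_point a}
    \<subseteq> interior (stacked_triangle i)"
proof -
  have "a = i \<or> a = i + 1 \<or> a = i + 2" using assms by linarith
  moreover have "stacked_triangle i = convex hull {stacked_point (i+1), stacked_point i, stacked_point (i+2)}"
    "stacked_triangle i = convex hull {stacked_point (i+2), stacked_point i, stacked_point (i+1)}"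
    by (simp_all add: stacked_triangle_def insert_commute)
  ultimately show ?thesis
    using segment_to_vertex_interior stacked_point_in_interior[of i] stacked_triangle_def[of i]
    by metis
qed

text \<open>Older edges never enter a later triangle. An edge ending at the newest point i+3 is a
  side of the next triangle or meets it only in that corner; earlier edges are handled by nesting
  and induction.\<close>

lemma stacked_edge_avoids_interior:
  assumes "a < b" "b \<le> a + 3" "3 \<le> b" "b < i + 3"
  shows "closed_segment (stacked_point a) (stacked_point b) \<inter> interior (stacked_triangle i) = {}"
  using assms(4)
proof (induction i)
  case 0
  then show ?case using assms by simp
next
  case (Suc i)
  let ?q = stacked_point
  have T: "stacked_triangle (Suc i) = convex hull {?q (i+1), ?q (i+2), ?q (i+3)}"
    by (simp add: stacked_triangle_def numeral_eq_Suc)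
  show ?case
  proof (cases "b = i + 3")
    case True
    then consider "a = i" | "a = i + 1" | "a = i + 2" using assms by linarith
    then show ?thesis
    proof cases
      case 1
      have "closed_segment (?q (i+3)) (?q i) \<inter> stacked_triangle (Suc i) = {?q (i+3)}"
        unfolding T using stacked_point_in_interior[of i]
        by (intro segment_to_vertex_Int_opposite) (simp add: stacked_triangle_def)
      moreover have "?q (i+3) \<notin> interior (stacked_triangle (Suc i))"
        unfolding T by (rule not_in_interior_convex_hull_3)
      ultimately have "x \<notin> interior (stacked_triangle (Suc i))"
        if "x \<in> closed_segment (?q (i+3)) (?q i)" for x
        using that interior_subset by (metis IntI singletonD subsetD)
      then show ?thesis
        unfolding 1 True closed_segment_commute[of "?q i"] by blast
    qed (use True in \<open>auto simp: T interior_of_triangle closed_segment_commute\<close>)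
  next
    case False
    have "{?q (i+1), ?q (i+2), ?q (i+3)} \<subseteq> stacked_triangle i"
      using stacked_point_in_interior[of i] interior_subset[of "stacked_triangle i"]
      by (auto simp: stacked_triangle_def hull_inc)
    then have "stacked_triangle (Suc i) \<subseteq> stacked_triangle i"
      unfolding T by (rule hull_minimal) (simp add: stacked_triangle_def)
    then have "interior (stacked_triangle (Suc i)) \<subseteq> interior (stacked_triangle i)"
      by (rule interior_mono)
    then show ?thesis using Suc False by auto
  qed
qed

lemma stacked_point_notin_interior:
  assumes "3 \<le> k" "k < i + 3"
  shows "stacked_point k \<notin> interior (stacked_triangle i)"
  using stacked_edge_avoids_interior[of "k - 1" k i] assms by auto

text \<open>The later point l is interior to triangle l-3, while an earlier point of index at least
  3 is not.\<close>

lemma stacked_point_inj: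
  assumes "3 \<le> k" "3 \<le> l" "stacked_point k = stacked_point l"
  shows "k = l"
proof -
  have False if "3 \<le> k" "k < l" "stacked_point k = stacked_point l" for k l
    using stacked_point_notin_interior[of k "l - 3"] stacked_point_in_interior[of "l - 3"] that
    by simp
  then show ?thesis using assms by (metis linorder_neqE_nat)
qed

text \<open>Two edges with the same later end leave it towards different corners. Otherwise the edge
  with the later end d is interior to triangle d-3 except at c, so the common point can only be c,
  which is then shown to be an end of the other edge.\<close>

lemma stacked_edges_meet:
  assumes ab: "3 \<le> a" "a < b" "b \<le> a + 3" and cd: "3 \<le> c" "c < d" "d \<le> c + 3"
    and "b \<le> d" "(a, b) \<noteq> (c, d)"
    and z: "z \<in> closed_segment (stacked_point a) (stacked_point b)"
      "z \<in> closed_segment (stacked_point c) (stacked_point d)"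
  shows "z \<in> stacked_point ` ({a, b} \<inter> {c, d})"
proof (cases "b = d")
  case True
  then obtain i where i: "b = i + 3" "d = i + 3" using ab by (metis add.commute le_Suc_ex less_imp_le_nat order_trans)
  let ?q = stacked_point
  have *: "closed_segment (?q (i+3)) (?q x) \<inter> convex hull {?q y, ?q y', ?q (i+3)} = {?q (i+3)}"
    if "{x, y, y'} = {i, i + 1, i + 2}" for x y y'
  proof (rule segment_to_vertex_Int_opposite)
    have "stacked_triangle i = convex hull (?q ` {x, y, y'})"
      unfolding that by (simp add: stacked_triangle_def)
    then show "?q (i+3) \<in> interior (convex hull {?q x, ?q y, ?q y'})"
      using stacked_point_in_interior[of i] by simp
  qed
  have "a = i \<or> a = i + 1 \<or> a = i + 2" "c = i \<or> c = i + 1 \<or> c = i + 2" "a \<noteq> c"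
    using assms i True by auto
  \<comment> \<open>The three corner indices sum to 3i+3, which determines the remaining
    one.\<close>
  then have "{a, c, 3 * i + 3 - a - c} = {i, i + 1, i + 2}"
    by (elim disjE) auto
  then obtain y' where "{a, c, y'} = {i, i + 1, i + 2}" by blast
  from *[OF this] have "closed_segment (?q b) (?q a) \<inter> convex hull {?q c, ?q y', ?q b} = {?q b}"
    by (simp add: i)
  moreover have "closed_segment (?q c) (?q d) \<subseteq> convex hull {?q c, ?q y', ?q b}"
    unfolding segment_convex_hull True by (rule hull_mono) auto
  ultimately have "z = ?q b" using z by (auto simp: closed_segment_commute)
  then show ?thesis using True by simp
next
  case False
  then have "b < d" using assms by simp
  have "z \<notin> interior (stacked_triangle (d - 3))"
    using stacked_edge_avoids_interior[of a b "d - 3"] ab \<open>b < d\<close> z by auto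
  moreover have "d - 3 \<le> c" using cd by simp
  ultimately have zc: "z = stacked_point c"
    using stacked_edge_interior[of c "d - 3"] cd z(2) by (auto simp: closed_segment_commute[of "stacked_point c"])
  have "c = a \<or> c = b"
  proof (rule ccontr)
    assume "\<not> (c = a \<or> c = b)"
    then consider "c > b" | "c < b" "c \<noteq> a" by linarith
    then show False
    proof cases
      case 1
      then have "z \<in> interior (stacked_triangle (c - 3))"
        using stacked_point_in_interior[of "c - 3"] cd zc by simp
      then show False
        using stacked_edge_avoids_interior[of a b "c - 3"] ab 1 z by auto
    next
      case 2
      then have "z \<noteq> stacked_point a" using zc stacked_point_inj ab cd by blast
      moreover have "b - 3 \<le> a" using ab by simp
      ultimately have "z \<in> interior (stacked_triangle (b - 3))"
        using stacked_edge_interior[of a "b - 3"] ab z(1)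
        by (auto simp: closed_segment_commute[of "stacked_point a"])
      then show False
        using stacked_point_notin_interior[of c "b - 3"] 2 cd zc by simp
    qed
  qed
  then show ?thesis using zc by auto
qed

text \<open>The shift by 3 makes every edge of the drawing end in the interior of an earlier triangle,
  so that the initial triangle needs no separate treatment.\<close>

lemma path_cube_drawing:
  "planar_straight_line_drawing {..<n} (path_cube n) (\<lambda>i. stacked_point (i + 3))"
  unfolding planar_straight_line_drawing_def
proof (intro conjI allI impI)
  let ?p = "\<lambda>i. stacked_point (i + 3)"
  show "inj_on ?p {..<n}"
    using stacked_point_inj[of "i + 3" "j + 3" for i j] by (auto simp: inj_on_def)
  \<comment> \<open>Written as hulls of images, segments depend only on the unordered edge, so its
    ends may be renamed in increasing order.\<close>
  have seg: "closed_segment (?p a) (?p b) = convex hull (?p ` {a, b})" for a b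
    by (simp add: segment_convex_hull)
  have meet: "convex hull (?p ` {a, b}) \<inter> convex hull (?p ` {c, d}) \<subseteq> ?p ` ({a, b} \<inter> {c, d})"
    if "a < b" "b \<le> a + 3" "c < d" "d \<le> c + 3" "{a, b} \<noteq> {c, d}" "b \<le> d" for a b c d
  proof
    fix z assume "z \<in> convex hull (?p ` {a, b}) \<inter> convex hull (?p ` {c, d})"
    then have "z \<in> stacked_point ` ({a + 3, b + 3} \<inter> {c + 3, d + 3})"
      unfolding seg[symmetric] by (intro stacked_edges_meet) (use that in auto)
    then show "z \<in> ?p ` ({a, b} \<inter> {c, d})" by auto
  qed
  fix u v x y
  assume uv: "{u, v} \<in> path_cube n" and xy: "{x, y} \<in> path_cube n" and ne: "{u, v} \<noteq> {x, y}"
  obtain a b where ab: "{u, v} = {a, b}" "a < b" "b \<le> a + 3"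
    using uv unfolding path_cube_def by blast
  obtain c d where cd: "{x, y} = {c, d}" "c < d" "d \<le> c + 3"
    using xy unfolding path_cube_def by blast
  show "closed_segment (?p u) (?p v) \<inter> closed_segment (?p x) (?p y) \<subseteq> ?p ` ({u, v} \<inter> {x, y})"
  proof (cases "b \<le> d")
    case True
    show ?thesis
      using meet[OF ab(2,3) cd(2,3) _ True] ne unfolding seg ab(1) cd(1) by simp
  next
    case False
    have "{c, d} \<noteq> {a, b}" "d \<le> b" using ne ab(1) cd(1) False by simp_all
    from meet[OF cd(2,3) ab(2,3) this] show ?thesis
      unfolding seg ab(1) cd(1) by (simp only: Int_commute)
  qed
qed

section \<open>Planarity of the graph and the linear bound\<close>

lemma planar_graph_if_straight_line_drawing:
  assumes "simple_graph V E" and p: "planar_straight_line_drawing V E p"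
  shows "planar_graph V E"
proof -
  have "\<forall>e\<in>E. \<exists>u v. e = {u, v} \<and> u \<noteq> v"
    using assms(1) by (auto simp: simple_graph_def card_2_iff)
  then obtain s t where st: "\<And>e. e \<in> E \<Longrightarrow> {s e, t e} = e" "\<And>e. e \<in> E \<Longrightarrow> s e \<noteq> t e"
    by metis
  have inj: "inj_on p V" using p by (simp add: planar_straight_line_drawing_def)
  let ?\<gamma> = "\<lambda>e. linepath (p (s e)) (p (t e))"
  have "arc (?\<gamma> e) \<and> {pathstart (?\<gamma> e), pathfinish (?\<gamma> e)} = p ` e" if "e \<in> E" for e
  proof -
    have "e \<subseteq> V" using assms(1) that by (simp add: simple_graph_def)
    then have "{s e, t e} \<subseteq> V" by (simp only: st that)
    then have "p (s e) \<noteq> p (t e)" using st(2)[OF that] inj_onD[OF inj, of "s e" "t e"] by blast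
    moreover have "p ` {s e, t e} = {p (s e), p (t e)}" by simp
    ultimately show ?thesis by (metis st(1) that arc_linepath pathstart_linepath pathfinish_linepath)
  qed
  then have arcs: "\<forall>e\<in>E. arc (?\<gamma> e) \<and> {pathstart (?\<gamma> e), pathfinish (?\<gamma> e)} = p ` e"
    by (intro ballI)
  have "path_image (?\<gamma> e) \<inter> path_image (?\<gamma> f) \<subseteq> p ` (e \<inter> f)"
    if "e \<in> E" "f \<in> E" "e \<noteq> f" for e f
  proof -
    note e = st(1)[OF that(1)] and f = st(1)[OF that(2)]
    have "{s e, t e} \<in> E" "{s f, t f} \<in> E" "{s e, t e} \<noteq> {s f, t f}"
      by (simp_all only: e f that not_False_eq_True)
    then have "path_image (?\<gamma> e) \<inter> path_image (?\<gamma> f) \<subseteq> p ` ({s e, t e} \<inter> {s f, t f})"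
      using p unfolding planar_straight_line_drawing_def path_image_linepath by blast
    then show ?thesis by (simp only: e f)
  qed
  then have meets: "\<forall>e\<in>E. \<forall>f\<in>E. e \<noteq> f \<longrightarrow>
      path_image (?\<gamma> e) \<inter> path_image (?\<gamma> f) \<subseteq> p ` (e \<inter> f)"
    by (intro ballI impI)
  show ?thesis
    unfolding planar_graph_def
    by (rule exI[of _ p], rule exI[of _ ?\<gamma>], intro conjI) (fact inj arcs meets)+
qed

theorem theorem1:
  "\<exists>c::real. c > 0 \<and>
     (\<forall>k::nat. k \<ge> 1 \<longrightarrow>
        (\<exists>(V :: nat set) (E :: nat set set).
           simple_graph V E \<and> planar_graph V E \<and> card V = 6 * k - 2 \<and>
           planar_edge_length_ratio V E \<ge> c * real (card V)))"
proof (intro exI[of _ "1/24"] conjI allI impI)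
  fix k :: nat assume k: "k \<ge> 1"
  define n m where "n = 6 * k - 2" and "m = 3 * k - 3"
  have n: "n = 2 * m + 4" using k by (simp add: n_def m_def)
  \<comment> \<open>Since n is at most 4 (m div 2) + 6, dividing by 24 matches the slope 1/6 of the
    ratio bound and leaves a constant below 1.\<close>
  have "real n / 24 \<le> 1 + real (m div 2) / 6"
  proof -
    have "n \<le> 4 * (m div 2) + 24" using n by linarith
    then have "real n \<le> real (4 * (m div 2) + 24)" by (simp only: of_nat_le_iff)
    then show ?thesis by simp
  qed
  then have "1/24 * real n \<le> edge_length_ratio (path_cube n) p"
    if "planar_straight_line_drawing {..<n} (path_cube n) p" for p
    using path_cube_edge_length_ratio[OF that n] by simp
  \<comment> \<open>The centroid drawing shows that the infimum is over a nonempty set, so the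
    uniform lower bound passes to it.\<close>
  then have "1/24 * real n \<le> planar_edge_length_ratio {..<n} (path_cube n)"
    unfolding planar_edge_length_ratio_def
    by (intro cInf_greatest) (use path_cube_drawing in auto)
  moreover have "planar_graph {..<n} (path_cube n)"
    using planar_graph_if_straight_line_drawing simple_graph_path_cube path_cube_drawing by blast
  ultimately show "\<exists>(V :: nat set) (E :: nat set set).
      simple_graph V E \<and> planar_graph V E \<and> card V = 6 * k - 2 \<and>
      planar_edge_length_ratio V E \<ge> 1/24 * real (card V)"
    using simple_graph_path_cube[of n]
    by (intro exI[of _ "{..<n}"] exI[of _ "path_cube n"]) (simp add: n_def)
qed simp

end
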